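(* Let $X\in\mathcal F$ be such that $X=Y_1\times Y_2\times\cdots\times Y_s=Z_1\times Z_2\times\cdots\times Z_t$, where the $Y_i$ and the $Z_i$ are irreducible elements of $\mathcal F$. Then $s=t$ and after a reordering of factors we have $Y_i=Z_i$ for $1\le i\le s$.
   Context: Let $\mathrm{Sym}_f(\mathbb N)$ be the group of finitary permutations of $\mathbb N$; for a set $X\subset\mathrm{Sym}_f(\mathbb N)$ let $\mathrm{supp}(X)=\bigcup_{\rho\in X}\mathrm{supp}(\rho)$. $\mathcal F$ is the collection of all finite nonempty subsets $X\ne\{1\}$ of $\mathrm{Sym}_f(\mathbb N)$. For $Y_1,\dots,Y_s\in\mathcal F$ with pairwise disjoint supports, $Y_1\times\cdots\times Y_s$ denotes the subset $\{y_1y_2\cdots y_s: y_i\in Y_i\}$ of $\mathrm{Sym}_f(\mathbb N)$; writing a product with $\times$ presupposes that the factors have pairwise disjoint supports. $X\in\mathcal F$ is irreducible if there do not exist $Y,Z\in\mathcal F$ with disjoint supports such that $X=Y\times Z$. The equalities $Y_i=Z_i$ are equalities of subsets of $\mathrm{Sym}_f(\mathbb N)$. *)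

theory Defs
  imports "HOL-Combinatorics.Perm" "HOL-Combinatorics.Permutations"
    "HOL-Library.Disjoint_Sets"
begin

text \<open>
  The group of finitary permutations of the natural numbers is the library type
  \<^typ>\<open>nat perm\<close> (finitely supported bijections under composition); the support
  of a single permutation is \<^term>\<open>affected\<close>.
\<close>

definition supp :: "nat perm set \<Rightarrow> nat set" where
  "supp X = (\<Union>\<rho>\<in>X. affected \<rho>)"

definition \<F> :: "nat perm set set" where
  "\<F> = {X. finite X \<and> X \<noteq> {} \<and> X \<noteq> {1}}"

text \<open>
  The set of ordered products \<open>y\<^sub>1 y\<^sub>2 \<dots> y\<^sub>s\<close> with \<open>y\<^sub>i \<in> Y\<^sub>i\<close>. Disjointness of supports,
  which the notation \<open>Y\<^sub>1 \<times> \<dots> \<times> Y\<^sub>s\<close> presupposes, is part of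
  \<open>is_product\<close> below.
\<close>

definition set_product :: "nat \<Rightarrow> (nat \<Rightarrow> nat perm set) \<Rightarrow> nat perm set" where
  "set_product s Y = {prod_list (map y [1..<Suc s]) | y. \<forall>i\<in>{1..s}. y i \<in> Y i}"

definition is_product :: "nat perm set \<Rightarrow> nat \<Rightarrow> (nat \<Rightarrow> nat perm set) \<Rightarrow> bool" where
  "is_product X s Y \<longleftrightarrow>
     disjoint_family_on (\<lambda>i. supp (Y i)) {1..s} \<and> X = set_product s Y"

definition irreducible_set :: "nat perm set \<Rightarrow> bool" where
  "irreducible_set X \<longleftrightarrow> X \<in> \<F> \<and>
     \<not> (\<exists>Y\<in>\<F>. \<exists>Z\<in>\<F>. supp Y \<inter> supp Z = {} \<and> X = {y * z | y z. y \<in> Y \<and> z \<in> Z})"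

end

theory Submission
  imports Defs
begin

text \<open>
  Say that a set \<open>A\<close> of points \<^emph>\<open>separates\<close> a set \<open>X\<close> of permutations if every element of \<open>X\<close> maps
  \<open>A\<close> onto itself and the parts of elements of \<open>X\<close> inside and outside \<open>A\<close> can be recombined freely
  within \<open>X\<close>. Splitting \<open>X\<close> as a product with disjoint supports amounts to finding separating sets:
  the support \<open>A\<close> of a factor separates \<open>X\<close>, and the factor is recovered from \<open>X\<close> and \<open>A\<close> alone, as
  the set of restrictions of elements of \<open>X\<close> to \<open>A\<close>.

  Uniqueness is then that of the atoms of an algebra of sets. If \<open>A\<close> and \<open>B\<close> both separate \<open>X\<close>, then
  the restriction of \<open>X\<close> to \<open>A\<close> is the product of its restrictions to \<open>A \<inter> B\<close> and to \<open>A - B\<close>. So if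
  that restriction is irreducible, its support cannot be cut by \<open>B\<close>: this is
  \<open>irreducible_restriction_not_cut\<close>. Applied to a factor of one decomposition
  and a factor of the other whose supports meet, it gives inclusion of the first support in the
  second; by symmetry the second is included in the support of some factor of the first
  decomposition, and disjointness makes the two supports equal. Equal supports mean equal factors
  (\<open>irreducible_factor_occurs\<close>). As irreducible factors of one decomposition are pairwise distinct
  (their supports are disjoint and nonempty), the correspondence is bijective.
\<close>

section \<open>Restricting a permutation to an invariant set\<close>

definition restrict_perm :: "'a set \<Rightarrow> 'a perm \<Rightarrow> 'a perm" where
  "restrict_perm A p = Perm (\<lambda>a. if a \<in> A then apply p a else a)"

lemma apply_restrict_perm:
  assumes "apply p ` A = A"
  shows "apply (restrict_perm A p) a = (if a \<in> A then apply p a else a)"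
proof -
  let ?f = "\<lambda>a. if a \<in> A then apply p a else a"
  have "inj_on (apply p) A"
    using bij_apply[of p] by (meson bij_is_inj inj_on_subset subset_UNIV)
  then have "bij_betw ?f A A"
    using assms by (auto simp: bij_betw_def inj_on_def)
  moreover have "bij_betw ?f (- A) (- A)"
    by (auto simp: bij_betw_def inj_on_def)
  ultimately have "bij_betw ?f (A \<union> - A) (A \<union> - A)"
    by (rule bij_betw_combine) simp
  moreover have "finite {a. ?f a \<noteq> a}"
    by (rule finite_subset[OF _ finite_affected[of p]]) (auto simp: in_affected split: if_splits)
  ultimately show ?thesis
    by (simp add: restrict_perm_def Perm_inverse)
qed

lemma image_eq_of_affected_subset:
  assumes "affected p \<subseteq> A"
  shows "apply p ` A = A"
proof
  show "apply p ` A \<subseteq> A"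
  proof
    fix b assume "b \<in> apply p ` A"
    then obtain a where "a \<in> A" "b = apply p a" by blast
    then show "b \<in> A"
      using assms apply_affected[of p a] by (cases "a \<in> affected p") (auto simp: in_affected)
  qed
next
  show "A \<subseteq> apply p ` A"
  proof
    fix b assume b: "b \<in> A"
    obtain a where a: "b = apply p a"
      using bij_apply[of p] by (meson bij_pointE)
    have "a \<in> A"
      using assms apply_affected[of p a] a b by (cases "a \<in> affected p") (auto simp: in_affected)
    with a show "b \<in> apply p ` A" by blast
  qed
qed

lemma supp_restrict_perm:
  assumes "\<And>x. x \<in> X \<Longrightarrow> apply x ` A = A"
  shows "supp (restrict_perm A ` X) = A \<inter> supp X"
  using assms by (auto simp: supp_def in_affected apply_restrict_perm split: if_splits)

lemma in_F_iff:
  "X \<in> \<F> \<longleftrightarrow> finite X \<and> supp X \<noteq> {}"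
proof -
  have "supp X \<noteq> {} \<longleftrightarrow> (\<exists>x\<in>X. x \<noteq> 1)"
    by (auto simp: supp_def)
  moreover have "X \<noteq> {} \<and> X \<noteq> {1} \<longleftrightarrow> (\<exists>x\<in>X. x \<noteq> 1)"
    by auto
  ultimately show ?thesis
    by (simp add: \<F>_def)
qed

section \<open>Separating sets\<close>

definition separates :: "'a set \<Rightarrow> 'a perm set \<Rightarrow> bool" where
  "separates A X \<longleftrightarrow>
     (\<forall>x\<in>X. apply x ` A = A) \<and>
     (\<forall>x\<in>X. \<forall>x'\<in>X. \<exists>z\<in>X. \<forall>a. apply z a = (if a \<in> A then apply x a else apply x' a))"

lemma separates_image:
  "separates A X \<Longrightarrow> x \<in> X \<Longrightarrow> apply x ` A = A"
  by (simp add: separates_def)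

lemma separates_mix:
  assumes "separates A X" "x \<in> X" "x' \<in> X"
  obtains z where "z \<in> X" "\<And>a. apply z a = (if a \<in> A then apply x a else apply x' a)"
  using assms unfolding separates_def by meson

text \<open>
  Recombining elements of \<open>X\<close> along \<open>B\<close> shows that the parts of a restriction to \<open>A\<close> inside
  and outside \<open>B\<close> are independent.
\<close>

lemma restriction_splits:
  assumes A: "separates A X" and B: "separates B X"
  shows "restrict_perm A ` X =
    {y * z | y z. y \<in> restrict_perm (A \<inter> B) ` X \<and> z \<in> restrict_perm (A - B) ` X}"
proof -
  have inj: "inj (apply x)" for x :: "'a perm"
    by (simp add: bij_is_inj)
  have AB: "apply x ` (A \<inter> B) = A \<inter> B" and AmB: "apply x ` (A - B) = A - B" if "x \<in> X" for x
    using that separates_image[OF A] separates_image[OF B]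
    by (simp_all add: image_Int[OF inj] image_set_diff[OF inj])
  have mult: "restrict_perm (A \<inter> B) x * restrict_perm (A - B) x' = restrict_perm A z"
    if x: "x \<in> X" "x' \<in> X" "z \<in> X"
      and z: "\<And>a. apply z a = (if a \<in> B then apply x a else apply x' a)" for x x' z
  proof (rule perm_eqI)
    fix a
    have "a \<in> A - B \<Longrightarrow> apply x' a \<in> A - B"
      using AmB[OF x(2)] by blast
    then show "apply (restrict_perm (A \<inter> B) x * restrict_perm (A - B) x') a
        = apply (restrict_perm A z) a"
      using x by (auto simp: apply_times apply_restrict_perm[OF AB] apply_restrict_perm[OF AmB]
          apply_restrict_perm[OF separates_image[OF A]] z)
  qed
  show ?thesis
  proof (intro subset_antisym subsetI)
    fix p assume "p \<in> restrict_perm A ` X"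
    then obtain x where x: "x \<in> X" "p = restrict_perm A x" by blast
    then have "p = restrict_perm (A \<inter> B) x * restrict_perm (A - B) x"
      using mult[of x x x] by simp
    with x(1) show "p \<in> {y * z | y z. y \<in> restrict_perm (A \<inter> B) ` X \<and> z \<in> restrict_perm (A - B) ` X}"
      by blast
  next
    fix p assume "p \<in> {y * z | y z. y \<in> restrict_perm (A \<inter> B) ` X \<and> z \<in> restrict_perm (A - B) ` X}"
    then obtain x x' where x: "x \<in> X" "x' \<in> X"
      and p: "p = restrict_perm (A \<inter> B) x * restrict_perm (A - B) x'" by blast
    obtain z where "z \<in> X" "\<And>a. apply z a = (if a \<in> B then apply x a else apply x' a)"
      using separates_mix[OF B x] by blast
    with mult[OF x] p show "p \<in> restrict_perm A ` X" by blast
  qed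
qed

text \<open>
  Otherwise \<open>restriction_splits\<close> would factor the restriction nontrivially: both
  \<open>A \<inter> B\<close> and \<open>A - B\<close> would contain points moved by \<open>X\<close>, so neither factor would be \<open>{1}\<close>.
\<close>

lemma irreducible_restriction_not_cut:
  assumes "finite X" and A: "separates A X" and B: "separates B X"
    and irr: "irreducible_set (restrict_perm A ` X)"
    and meet: "A \<inter> B \<inter> supp X \<noteq> {}"
  shows "A \<inter> supp X \<subseteq> B"
proof (rule ccontr)
  assume "\<not> A \<inter> supp X \<subseteq> B"
  then have diff: "(A - B) \<inter> supp X \<noteq> {}" by blast
  have inj: "inj (apply x)" for x :: "nat perm"
    by (simp add: bij_is_inj)
  have supps: "supp (restrict_perm (A \<inter> B) ` X) = A \<inter> B \<inter> supp X"
    "supp (restrict_perm (A - B) ` X) = (A - B) \<inter> supp X"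
    by (rule supp_restrict_perm;
        simp add: image_Int[OF inj] image_set_diff[OF inj] separates_image[OF A]
          separates_image[OF B])+
  then have "restrict_perm (A \<inter> B) ` X \<in> \<F>" "restrict_perm (A - B) ` X \<in> \<F>"
    using \<open>finite X\<close> meet diff by (simp_all add: in_F_iff)
  moreover have "supp (restrict_perm (A \<inter> B) ` X) \<inter> supp (restrict_perm (A - B) ` X) = {}"
    using supps by blast
  ultimately show False
    using irr restriction_splits[OF A B] unfolding irreducible_set_def by blast
qed

section \<open>Factors of a product decomposition\<close>

lemma apply_prod_list_outside:
  assumes "\<And>i. i \<in> set l \<Longrightarrow> a \<notin> affected (y i)"
  shows "apply (prod_list (map y l)) a = a"
  using assms by (induction l) (auto simp: apply_times in_affected)

lemma apply_prod_list_inside: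
  assumes "distinct l" "disjoint_family_on S (set l)" "\<And>i. i \<in> set l \<Longrightarrow> affected (y i) \<subseteq> S i"
    and "i \<in> set l" "a \<in> S i"
  shows "apply (prod_list (map y l)) a = apply (y i) a"
  using assms
proof (induction l)
  case Nil
  then show ?case by simp
next
  case (Cons j l)
  have disj: "k \<noteq> k' \<Longrightarrow> k \<in> set (j # l) \<Longrightarrow> k' \<in> set (j # l) \<Longrightarrow> S k \<inter> S k' = {}" for k k'
    using disjoint_family_onD[OF Cons.prems(2)] by blast
  show ?case
  proof (cases "i = j")
    case True
    have "a \<notin> affected (y k)" if "k \<in> set l" for k
      using that True Cons.prems disj[of k j] by force
    then show ?thesis
      using True by (simp add: apply_times apply_prod_list_outside)
  next
    case False
    then have i: "i \<in> set l" using Cons.prems by simp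
    have "apply (prod_list (map y l)) a = apply (y i) a"
      using Cons.prems i by (intro Cons.IH) (auto simp: disjoint_family_on_def)
    moreover have "apply (y i) a \<in> S i"
      using image_eq_of_affected_subset[OF Cons.prems(3)[of i]] i Cons.prems(5) by auto
    then have "apply (y i) a \<notin> affected (y j)"
      using disj[of i j] False i Cons.prems(3)[of j] by auto
    ultimately show ?thesis
      by (simp add: apply_times in_affected)
  qed
qed

lemma set_product_elem:
  assumes "disjoint_family_on (\<lambda>i. supp (Y i)) {1..s}" and y: "\<And>i. i \<in> {1..s} \<Longrightarrow> y i \<in> Y i"
  shows "\<And>i a. i \<in> {1..s} \<Longrightarrow> a \<in> supp (Y i) \<Longrightarrow>
      apply (prod_list (map y [1..<Suc s])) a = apply (y i) a"
    and "\<And>a. a \<notin> (\<Union>i\<in>{1..s}. supp (Y i)) \<Longrightarrow> apply (prod_list (map y [1..<Suc s])) a = a"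
proof -
  have idx: "set [1..<Suc s] = {1..s}" by auto
  have aff: "affected (y i) \<subseteq> supp (Y i)" if "i \<in> {1..s}" for i
    using y[OF that] by (auto simp: supp_def)
  show "apply (prod_list (map y [1..<Suc s])) a = apply (y i) a"
    if "i \<in> {1..s}" "a \<in> supp (Y i)" for i a
    by (rule apply_prod_list_inside[where S = "\<lambda>i. supp (Y i)"])
      (use assms(1) aff that in \<open>simp_all only: idx distinct_upt\<close>)
  show "apply (prod_list (map y [1..<Suc s])) a = a"
    if "a \<notin> (\<Union>i\<in>{1..s}. supp (Y i))" for a
    by (rule apply_prod_list_outside) (use aff that in \<open>unfold idx, blast\<close>)
qed

text \<open>
  Exchanging the entry at position \<open>i\<close> between two factorizations recombines two elements
  of \<open>X\<close> along the support of the \<open>i\<close>-th factor.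
\<close>

lemma supp_factor_separates:
  assumes "is_product X s Y" and i: "i \<in> {1..s}"
  shows "separates (supp (Y i)) X"
proof -
  have disj: "disjoint_family_on (\<lambda>i. supp (Y i)) {1..s}" and X: "X = set_product s Y"
    using assms(1) by (auto simp: is_product_def)
  note inside = set_product_elem(1)[OF disj] and outside = set_product_elem(2)[OF disj]
  have "apply x ` supp (Y i) = supp (Y i)" if x: "x \<in> X" for x
  proof -
    obtain y where y: "\<And>j. j \<in> {1..s} \<Longrightarrow> y j \<in> Y j" and "x = prod_list (map y [1..<Suc s])"
      using x unfolding X set_product_def by blast
    then have "apply x ` supp (Y i) = apply (y i) ` supp (Y i)"
      using inside[OF y i] by (intro image_cong) auto
    also have "\<dots> = supp (Y i)"
      using y[OF i] by (intro image_eq_of_affected_subset) (auto simp: supp_def)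
    finally show ?thesis .
  qed
  moreover have "\<exists>z\<in>X. \<forall>a. apply z a = (if a \<in> supp (Y i) then apply x a else apply x' a)"
    if mem: "x \<in> X" "x' \<in> X" for x x'
  proof -
    obtain y where y: "\<And>j. j \<in> {1..s} \<Longrightarrow> y j \<in> Y j" and x: "x = prod_list (map y [1..<Suc s])"
      using mem(1) unfolding X set_product_def by blast
    obtain y' where y': "\<And>j. j \<in> {1..s} \<Longrightarrow> y' j \<in> Y j" and x': "x' = prod_list (map y' [1..<Suc s])"
      using mem(2) unfolding X set_product_def by blast
    \<comment> \<open>The support of \<open>Y i\<close> sees only the \<open>i\<close>-th entry of a factorization, its complement only the others.\<close>
    define w where "w = y'(i := y i)"
    have w: "\<And>j. j \<in> {1..s} \<Longrightarrow> w j \<in> Y j"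
      using y y' by (simp add: w_def)
    define z where "z = prod_list (map w [1..<Suc s])"
    have "z \<in> X"
      using w unfolding X set_product_def z_def by blast
    moreover have "apply z a = (if a \<in> supp (Y i) then apply x a else apply x' a)" for a
    proof (cases "a \<in> (\<Union>j\<in>{1..s}. supp (Y j))")
      case True
      then obtain j where j: "j \<in> {1..s}" "a \<in> supp (Y j)" by blast
      have "a \<notin> supp (Y i)" if "i \<noteq> j"
        using disjoint_family_onD[OF disj i j(1) that] j(2) by blast
      moreover have "w j = (if i = j then y j else y' j)"
        by (simp add: w_def)
      ultimately show ?thesis
        using inside[OF y j] inside[OF y' j] inside[OF w j] j(2) unfolding x x' z_def by metis
    next
      case False
      then have "a \<notin> supp (Y i)"
        using i by blast
      then show ?thesis
        using outside[OF y' False] outside[OF w False] by (simp only: x' z_def if_False)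
    qed
    ultimately show ?thesis by blast
  qed
  ultimately show ?thesis
    unfolding separates_def by blast
qed

text \<open>
  A factor is determined by its support, since the other factors fix that support pointwise.
  Nonemptiness of all factors is what makes each \<open>v \<in> Y i\<close> occur as an entry in some element of \<open>X\<close>.
\<close>

lemma factor_eq_restriction:
  assumes "is_product X s Y" and i: "i \<in> {1..s}" and ne: "\<And>j. j \<in> {1..s} \<Longrightarrow> Y j \<noteq> {}"
  shows "Y i = restrict_perm (supp (Y i)) ` X"
proof -
  have disj: "disjoint_family_on (\<lambda>i. supp (Y i)) {1..s}" and X: "X = set_product s Y"
    using assms(1) by (auto simp: is_product_def)
  have restr: "restrict_perm (supp (Y i)) (prod_list (map y [1..<Suc s])) = y i"
    if y: "\<And>j. j \<in> {1..s} \<Longrightarrow> y j \<in> Y j" for y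
  proof (rule perm_eqI)
    fix a
    have "prod_list (map y [1..<Suc s]) \<in> X"
      using y unfolding X set_product_def by blast
    then have inv: "apply (prod_list (map y [1..<Suc s])) ` supp (Y i) = supp (Y i)"
      by (rule separates_image[OF supp_factor_separates[OF assms(1) i]])
    have "a \<notin> supp (Y i) \<Longrightarrow> apply (y i) a = a"
      using y[OF i] by (auto simp: supp_def in_affected)
    then show "apply (restrict_perm (supp (Y i)) (prod_list (map y [1..<Suc s]))) a = apply (y i) a"
      using set_product_elem(1)[OF disj y i] unfolding apply_restrict_perm[OF inv] by metis
  qed
  show ?thesis
  proof (intro subset_antisym subsetI)
    fix v assume v: "v \<in> Y i"
    define y where "y = (\<lambda>j. SOME p. p \<in> Y j)(i := v)"
    have y: "\<And>j. j \<in> {1..s} \<Longrightarrow> y j \<in> Y j"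
      using v ne by (auto simp: y_def some_in_eq)
    then have "prod_list (map y [1..<Suc s]) \<in> X"
      unfolding X set_product_def by blast
    moreover have "restrict_perm (supp (Y i)) (prod_list (map y [1..<Suc s])) = v"
      using restr[OF y] by (simp only: y_def fun_upd_same)
    ultimately show "v \<in> restrict_perm (supp (Y i)) ` X" by blast
  next
    fix v assume "v \<in> restrict_perm (supp (Y i)) ` X"
    then obtain y where y: "\<And>j. j \<in> {1..s} \<Longrightarrow> y j \<in> Y j"
      and "v = restrict_perm (supp (Y i)) (prod_list (map y [1..<Suc s]))"
      unfolding X set_product_def by blast
    with restr[OF y] y[OF i] show "v \<in> Y i" by simp
  qed
qed

lemma supp_product_subset:
  assumes "is_product X s Y"
  shows "supp X \<subseteq> (\<Union>i\<in>{1..s}. supp (Y i))"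
proof
  fix a assume "a \<in> supp X"
  then obtain x where "x \<in> X" and a: "apply x a \<noteq> a"
    by (auto simp: supp_def in_affected)
  then obtain y where y: "\<And>j. j \<in> {1..s} \<Longrightarrow> y j \<in> Y j" and x: "x = prod_list (map y [1..<Suc s])"
    using assms unfolding is_product_def set_product_def by blast
  show "a \<in> (\<Union>i\<in>{1..s}. supp (Y i))"
  proof (rule ccontr)
    assume "a \<notin> (\<Union>i\<in>{1..s}. supp (Y i))"
    with set_product_elem(2)[where Y = Y, OF _ y] assms a x show False
      unfolding is_product_def by blast
  qed
qed

section \<open>Comparing two decompositions into irreducible factors\<close>

lemma irreducible_set_supp_nonempty:
  "irreducible_set X \<Longrightarrow> supp X \<noteq> {}"
  by (simp add: irreducible_set_def in_F_iff)

lemma irreducible_factors_inj: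
  assumes "is_product X s Y" and irr: "\<And>i. i \<in> {1..s} \<Longrightarrow> irreducible_set (Y i)"
  shows "inj_on Y {1..s}"
proof (rule inj_onI)
  fix i j assume ij: "i \<in> {1..s}" "j \<in> {1..s}" "Y i = Y j"
  show "i = j"
  proof (rule ccontr)
    assume "i \<noteq> j"
    then have "supp (Y i) \<inter> supp (Y j) = {}"
      using assms(1) ij disjoint_family_onD unfolding is_product_def by fast
    with irreducible_set_supp_nonempty[OF irr[OF ij(1)]] ij(3) show False by simp
  qed
qed

text \<open>
  A moved point of \<open>Y i\<close> lies in the support of some \<open>Z j\<close>, and this support, being separating,
  cannot cut that of the irreducible \<open>Y i\<close>.
\<close>

lemma supp_factor_subset_supp_factor:
  assumes fin: "finite X" and XY: "is_product X s Y" and XZ: "is_product X t Z"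
    and irrY: "\<And>i. i \<in> {1..s} \<Longrightarrow> irreducible_set (Y i)"
    and i: "i \<in> {1..s}"
  shows "\<exists>j\<in>{1..t}. supp (Y i) \<subseteq> supp (Z j)"
proof -
  have sepY: "separates (supp (Y i)) X"
    by (rule supp_factor_separates[OF XY i])
  have ne: "Y k \<noteq> {}" if "k \<in> {1..s}" for k
    using irrY[OF that] by (auto simp: irreducible_set_def \<F>_def)
  have Yi: "Y i = restrict_perm (supp (Y i)) ` X"
    by (rule factor_eq_restriction[OF XY i ne])
  then have sub: "supp (Y i) \<subseteq> supp X"
    using supp_restrict_perm[of X, OF separates_image[OF sepY]] by auto
  obtain a where a: "a \<in> supp (Y i)"
    using irreducible_set_supp_nonempty[OF irrY[OF i]] by blast
  then obtain j where j: "j \<in> {1..t}" "a \<in> supp (Z j)"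
    using sub supp_product_subset[OF XZ] by blast
  have "supp (Y i) \<inter> supp X \<subseteq> supp (Z j)"
  proof (rule irreducible_restriction_not_cut[OF fin sepY])
    show "separates (supp (Z j)) X"
      by (rule supp_factor_separates[OF XZ j(1)])
    show "irreducible_set (restrict_perm (supp (Y i)) ` X)"
      using irrY[OF i] Yi by simp
    show "supp (Y i) \<inter> supp (Z j) \<inter> supp X \<noteq> {}"
      using a j sub by blast
  qed
  with sub j show ?thesis by blast
qed

lemma irreducible_factor_occurs:
  assumes fin: "finite X" and XY: "is_product X s Y" and XZ: "is_product X t Z"
    and irrY: "\<And>i. i \<in> {1..s} \<Longrightarrow> irreducible_set (Y i)"
    and irrZ: "\<And>i. i \<in> {1..t} \<Longrightarrow> irreducible_set (Z i)"
    and i: "i \<in> {1..s}"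
  shows "Y i \<in> Z ` {1..t}"
proof -
  obtain j where j: "j \<in> {1..t}" "supp (Y i) \<subseteq> supp (Z j)"
    using supp_factor_subset_supp_factor[OF fin XY XZ irrY i] by blast
  obtain k where k: "k \<in> {1..s}" "supp (Z j) \<subseteq> supp (Y k)"
    using supp_factor_subset_supp_factor[OF fin XZ XY irrZ j(1)] by blast
  have "supp (Y i) \<inter> supp (Y k) \<noteq> {}"
    using j k irreducible_set_supp_nonempty[OF irrY[OF i]] by blast
  then have "i = k"
    using XY i k disjoint_family_onD unfolding is_product_def by fast
  with j k have eq: "supp (Y i) = supp (Z j)" by blast
  have "Y i = restrict_perm (supp (Y i)) ` X"
    using irrY by (intro factor_eq_restriction[OF XY i]) (auto simp: irreducible_set_def \<F>_def)
  moreover have "Z j = restrict_perm (supp (Z j)) ` X"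
    using irrZ by (intro factor_eq_restriction[OF XZ j(1)]) (auto simp: irreducible_set_def \<F>_def)
  ultimately show ?thesis
    using eq j(1) by simp
qed

theorem lemma3p9:
  fixes X :: "nat perm set" and Y Z :: "nat \<Rightarrow> nat perm set" and s t :: nat
  assumes "X \<in> \<F>"
    and "is_product X s Y" and "is_product X t Z"
    and "\<And>i. i \<in> {1..s} \<Longrightarrow> irreducible_set (Y i)"
    and "\<And>i. i \<in> {1..t} \<Longrightarrow> irreducible_set (Z i)"
  shows "s = t \<and> (\<exists>\<pi>. \<pi> permutes {1..s} \<and> (\<forall>i\<in>{1..s}. Y i = Z (\<pi> i)))"
proof -
  have fin: "finite X"
    using assms(1) by (simp add: \<F>_def)
  have eq: "Y ` {1..s} = Z ` {1..t}"
    using irreducible_factor_occurs[OF fin assms(2,3,4,5)]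
      irreducible_factor_occurs[OF fin assms(3,2,5,4)] by blast
  have injY: "inj_on Y {1..s}" and injZ: "inj_on Z {1..t}"
    using irreducible_factors_inj assms(2-5) by blast+
  have st: "s = t"
    using card_image[OF injY] card_image[OF injZ] eq by simp
  define \<pi> where "\<pi> i = (if i \<in> {1..s} then the_inv_into {1..t} Z (Y i) else i)" for i
  have Y: "bij_betw Y {1..s} (Z ` {1..t})"
    using injY eq by (simp add: bij_betw_def)
  have "bij_betw (the_inv_into {1..t} Z) (Z ` {1..t}) {1..t}"
    using injZ by (intro bij_betw_the_inv_into) (simp add: bij_betw_def)
  then have "bij_betw (the_inv_into {1..t} Z \<circ> Y) {1..s} {1..t}"
    using Y bij_betw_trans by blast
  then have "bij_betw \<pi> {1..s} {1..s}"
    unfolding st by (rule bij_betw_cong[THEN iffD1, rotated]) (simp add: \<pi>_def st)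
  then have "\<pi> permutes {1..s}"
    by (rule bij_imp_permutes) (simp only: \<pi>_def if_False)
  moreover have "Y i = Z (\<pi> i)" if "i \<in> {1..s}" for i
  proof -
    have "Y i \<in> Z ` {1..t}"
      using that eq by blast
    then show ?thesis
      using f_the_inv_into_f[OF injZ] that by (simp only: \<pi>_def if_True)
  qed
  ultimately show ?thesis
    using st by blast
qed

end
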